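(* Let $P$ be an algebraic polynomial of degree $n\ge 1$ with $P(1)=1$, and let $z_1,\dots,z_n$ be its roots, listed with multiplicity. Suppose that all the roots $z_1,\dots,z_n$ are real and at least one of them equals $-1$. For $\varphi\in\mathbb{R}$ let $$T(\varphi)=|P(e^{i\varphi})|^2+|P(-e^{i\varphi})|^2 .$$ Let $\rho_0,\dots,\rho_n$ be the normalized elementary symmetric polynomials of the numbers $a_i=1+\frac{2z_i}{(z_i-1)^2}$, $i=1,\dots,n$ (as defined in the context). If $$\Delta^{2k}\rho_{n-2k}:=\sum_{j=n-2k}^{n}\binom{2k}{n-j}(-1)^{n-j}\rho_j\ge 0\qquad\text{for every integer } k \text{ with } 0\le k\le \lfloor n/2\rfloor,$$ then $T(\varphi)\le 1$ for every $\varphi\in\mathbb{R}$.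
   Context: Algebraic polynomials have complex coefficients. The condition $P(1)=1$ guarantees that no root equals $1$, so the numbers $a_i=1+\frac{2z_i}{(z_i-1)^2}$ are well defined. For $0\le k\le n$ put $$\sigma_k=\sum_{\substack{S\subset\{1,\dots,n\}\\ \#S=k}}\ \prod_{j\in S}a_j$$ (the $k$-th elementary symmetric polynomial of $a_1,\dots,a_n$, with $\sigma_0=1$) and $$\rho_k=\frac{\sigma_k}{\binom{n}{k}} .$$ *)

theory Defs
  imports Complex_Main "HOL-Computational_Algebra.Computational_Algebra"
begin

(* Only meaningful for w \<noteq> 1; by x / 0 = 0 the value at w = 1 is 1. *)
definition root_transform :: "'a::field \<Rightarrow> 'a" where
  "root_transform w = 1 + 2 * w / (w - 1)^2"

definition elem_sym :: "nat \<Rightarrow> (nat \<Rightarrow> 'a::comm_ring_1) \<Rightarrow> nat \<Rightarrow> 'a" where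
  "elem_sym n a k = (\<Sum>S | S \<subseteq> {1..n} \<and> card S = k. \<Prod>j\<in>S. a j)"

definition norm_elem_sym :: "nat \<Rightarrow> (nat \<Rightarrow> 'a::field_char_0) \<Rightarrow> nat \<Rightarrow> 'a" where
  "norm_elem_sym n a k = elem_sym n a k / of_nat (n choose k)"

definition T :: "complex poly \<Rightarrow> real \<Rightarrow> real" where
  "T P \<phi> = (cmod (poly P (cis \<phi>)))^2 + (cmod (poly P (- cis \<phi>)))^2"

end

theory Submission
  imports Defs
begin

text \<open>
  For a real root \<open>w \<noteq> 1\<close> with transform \<open>a = (1 + w^2) / (w - 1)^2\<close> and a point on the unit
  circle with real part \<open>c\<close>, the factor of \<open>|P|^2\<close> belonging to \<open>w\<close>, normalized by its value at
  \<open>1\<close>, is \<open>a (1 - c) + c\<close>; it is affine in \<open>c\<close> (lemma \<open>cmod_sub_real_root\<close>). Hence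
  \<open>T(\<phi>) = Q(c) + Q(- c)\<close>, where \<open>c = cos \<phi>\<close> and \<open>Q(c) = \<Prod>\<^sub>i (a\<^sub>i (1 - c) + c)\<close>.

  Expanding this product shows that the \<open>\<rho>\<^sub>k\<close> are the Bernstein coefficients of \<open>Q\<close> in the
  variable \<open>1 - c\<close>. As always for Bernstein forms, the monomial coefficients are binomial
  multiples of the iterated differences of the Bernstein coefficients
  (lemma \<open>prod_affine_difference_expansion\<close>): up to the sign \<open>(-1)^m\<close> and the positive
  factor \<open>n choose m\<close>, the coefficient of \<open>c^m\<close> is the \<open>m\<close>-th difference of \<open>\<rho>\<close> starting at
  \<open>n - m\<close>. In \<open>Q(c) + Q(- c)\<close> the odd powers cancel, and the hypothesis says that the
  coefficients of the even powers are nonnegative. So this sum is largest over \<open>|c| \<le> 1\<close> at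
  \<open>c = 1\<close>, where it is \<open>Q(1) + Q(-1) = 1 + \<Prod>\<^sub>i (2 a\<^sub>i - 1)\<close>. A root \<open>-1\<close> has \<open>a\<^sub>i = 1/2\<close>
  and makes the last product vanish, so that the maximum is \<open>1\<close>.
\<close>

lemma prod_homogeneous_elem_sym:
  fixes a :: "nat \<Rightarrow> 'a::comm_ring_1"
  shows "(\<Prod>i=1..n. a i * x + y) = (\<Sum>k\<le>n. elem_sym n a k * x ^ k * y ^ (n - k))"
proof -
  have card_le: "card S \<le> n" if "S \<subseteq> {1..n}" for S
    using card_mono[OF finite_atLeastAtMost that] by simp
  have "(\<Prod>i=1..n. a i * x + y)
      = (\<Sum>S\<in>Pow {1..n}. (\<Prod>i\<in>S. a i * x) * (\<Prod>i\<in>{1..n} - S. y))"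
    by (rule prod_add) simp
  also have "\<dots> = (\<Sum>S\<in>Pow {1..n}. (\<Prod>i\<in>S. a i) * x ^ card S * y ^ (n - card S))"
    by (intro sum.cong refl) (auto simp: prod.distrib card_Diff_subset finite_subset)
  also have "\<dots> = (\<Sum>k\<le>n. \<Sum>S | S \<in> Pow {1..n} \<and> card S = k.
                      (\<Prod>i\<in>S. a i) * x ^ card S * y ^ (n - card S))"
    by (rule sum.group[symmetric]) (use card_le in auto)
  also have "\<dots> = (\<Sum>k\<le>n. elem_sym n a k * x ^ k * y ^ (n - k))"
    unfolding elem_sym_def sum_distrib_right by (intro sum.cong) auto
  finally show ?thesis .
qed

text \<open>
  The single Bernstein polynomial case of the passage to monomials. The exponent \<open>m + l\<close> of the
  sign has the parity of \<open>m - l\<close>, and the terms with \<open>m < l\<close> vanish because \<open>m choose l = 0\<close>.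
\<close>

lemma bernstein_monomial_expansion:
  fixes c :: "'a::comm_ring_1"
  assumes "l \<le> n"
  shows "of_nat (n choose l) * (1 - c) ^ (n - l) * c ^ l
       = (\<Sum>m\<le>n. of_nat (n choose m) * of_nat (m choose l) * (-1) ^ (m + l) * c ^ m)"
proof -
  have "(1 - c) ^ (n - l) = (\<Sum>i\<le>n - l. of_nat ((n - l) choose i) * (- c) ^ i)"
    using binomial_ring[of "- c" 1 "n - l"] by simp
  then have "of_nat (n choose l) * (1 - c) ^ (n - l) * c ^ l
      = (\<Sum>i\<le>n - l. of_nat (n choose l) * of_nat ((n - l) choose i) * (- c) ^ i * c ^ l)"
    by (simp add: sum_distrib_left sum_distrib_right mult.assoc)
  also have "\<dots> = (\<Sum>m\<in>{l..n}. of_nat (n choose l) * of_nat ((n - l) choose (m - l))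
                               * (- c) ^ (m - l) * c ^ l)"
    by (rule sum.reindex_bij_witness[of _ "\<lambda>m. m - l" "\<lambda>i. i + l"]) (use assms in auto)
  also have "\<dots> = (\<Sum>m\<in>{l..n}. of_nat (n choose m) * of_nat (m choose l) * (-1) ^ (m + l) * c ^ m)"
  proof (rule sum.cong[OF refl])
    fix m assume "m \<in> {l..n}"
    then have m: "l \<le> m" "m \<le> n" by auto
    have binom: "of_nat (n choose l) * of_nat ((n - l) choose (m - l))
        = (of_nat (n choose m) * of_nat (m choose l) :: 'a)"
      by (simp only: of_nat_mult[symmetric] choose_mult[OF m])
    have "(- c) ^ (m - l) * c ^ l = (-1) ^ (m - l) * (c ^ (m - l) * c ^ l)"
      by (subst power_minus) (simp add: mult.assoc)
    also have "c ^ (m - l) * c ^ l = c ^ m"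
      using m by (simp flip: power_add)
    also have "(-1) ^ (m - l) = ((-1) ^ (m + l) :: 'a)"
      using m by (simp add: minus_one_power_iff)
    finally show "of_nat (n choose l) * of_nat ((n - l) choose (m - l)) * (- c) ^ (m - l) * c ^ l
        = of_nat (n choose m) * of_nat (m choose l) * (-1) ^ (m + l) * c ^ m"
      by (simp add: binom mult.assoc)
  qed
  also have "\<dots> = (\<Sum>m\<le>n. of_nat (n choose m) * of_nat (m choose l) * (-1) ^ (m + l) * c ^ m)"
    by (rule sum.mono_neutral_left) (auto simp: binomial_eq_0)
  finally show ?thesis .
qed

text \<open>
  The inner sum is the \<open>m\<close>-th iterated difference of the normalized symmetric functions. It may
  run over all indices, since \<open>m choose (n - j) = 0\<close> for \<open>j < n - m\<close>.
\<close>

lemma prod_affine_difference_expansion: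
  fixes a :: "nat \<Rightarrow> 'a::field_char_0"
  shows "(\<Prod>i=1..n. a i * (1 - c) + c)
       = (\<Sum>m\<le>n. of_nat (n choose m)
            * (\<Sum>j\<le>n. of_nat (m choose (n - j)) * (-1) ^ (n - j) * norm_elem_sym n a j)
            * (- c) ^ m)"
proof -
  have "(\<Prod>i=1..n. a i * (1 - c) + c) = (\<Sum>j\<le>n. elem_sym n a j * (1 - c) ^ j * c ^ (n - j))"
    by (rule prod_homogeneous_elem_sym)
  also have "\<dots> = (\<Sum>j\<le>n. norm_elem_sym n a j *
                     (\<Sum>m\<le>n. of_nat (n choose m) * of_nat (m choose (n - j))
                              * (-1) ^ (m + (n - j)) * c ^ m))"
  proof (rule sum.cong[OF refl])
    fix j assume "j \<in> {..n}"
    then have j: "j \<le> n" by simp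
    have "elem_sym n a j = norm_elem_sym n a j * of_nat (n choose (n - j))"
      using j by (simp add: norm_elem_sym_def binomial_symmetric[symmetric])
    then show "elem_sym n a j * (1 - c) ^ j * c ^ (n - j) = norm_elem_sym n a j *
                 (\<Sum>m\<le>n. of_nat (n choose m) * of_nat (m choose (n - j))
                          * (-1) ^ (m + (n - j)) * c ^ m)"
      using bernstein_monomial_expansion[of "n - j" n c] j by (simp add: mult.assoc)
  qed
  also have "\<dots> = (\<Sum>m\<le>n. \<Sum>j\<le>n. norm_elem_sym n a j *
                     (of_nat (n choose m) * of_nat (m choose (n - j))
                              * (-1) ^ (m + (n - j)) * c ^ m))"
    unfolding sum_distrib_left by (rule sum.swap)
  also have "\<dots> = (\<Sum>m\<le>n. of_nat (n choose m)
            * (\<Sum>j\<le>n. of_nat (m choose (n - j)) * (-1) ^ (n - j) * norm_elem_sym n a j)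
            * (- c) ^ m)"
    unfolding sum_distrib_left sum_distrib_right power_minus[of c] power_add
    by (intro sum.cong refl) (simp add: mult_ac)
  finally show ?thesis .
qed

text \<open>
  Both sides equal \<open>1 + w^2 - 2 w Re u\<close>: on the unit circle the squared distance to a real point
  depends only on the real part.
\<close>

lemma cmod_sub_real_root:
  fixes w :: real
  assumes "cmod u = 1" and "w \<noteq> 1"
  shows "(cmod (u - complex_of_real w))\<^sup>2
       = (1 - w)\<^sup>2 * (root_transform w * (1 - Re u) + Re u)"
proof -
  have unit: "(Re u)\<^sup>2 + (Im u)\<^sup>2 = 1"
    using assms(1) cmod_power2[of u] by simp
  have "(1 - w)\<^sup>2 * root_transform w = 1 + w\<^sup>2"
    using assms(2)
    by (simp add: root_transform_def distrib_left power2_commute[of 1 w]) (simp add: power2_diff)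
  then have "(1 - w)\<^sup>2 * (root_transform w * (1 - Re u) + Re u)
      = (1 + w\<^sup>2) * (1 - Re u) + (1 - w)\<^sup>2 * Re u"
    by (simp add: distrib_left flip: mult.assoc)
  then show ?thesis
    using unit by (simp add: cmod_power2) algebra
qed

lemma cmod_poly_real_roots_unit_circle:
  fixes P :: "complex poly" and z :: "nat \<Rightarrow> real"
  assumes "poly P 1 = 1"
    and "proots P = image_mset (\<lambda>i. complex_of_real (z i)) (mset_set {1..n})"
    and "cmod u = 1"
  shows "(cmod (poly P u))\<^sup>2 = (\<Prod>i=1..n. root_transform (z i) * (1 - Re u) + Re u)"
proof -
  have poly_P: "poly P v = lead_coeff P * (\<Prod>i=1..n. v - complex_of_real (z i))" for v
  proof -
    have "P = smult (lead_coeff P) (\<Prod>i=1..n. [:- complex_of_real (z i), 1:])"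
      using complex_poly_decompose_multiset[of P] unfolding assms(2)
      by (simp add: multiset.map_comp comp_def flip: prod_unfold_prod_mset)
    then have "poly P v = poly (smult (lead_coeff P) (\<Prod>i=1..n. [:- complex_of_real (z i), 1:])) v"
      by simp
    then show ?thesis
      by (simp add: poly_prod)
  qed
  have z_ne_1: "z i \<noteq> 1" if "i \<in> {1..n}" for i
  proof
    assume "z i = 1"
    then have "(\<Prod>i=1..n. 1 - complex_of_real (z i)) = 0"
      using that by (intro prod_zero) auto
    then have "poly P 1 = 0"
      by (simp only: poly_P mult_zero_right)
    then show False
      using assms(1) by simp
  qed
  have cmod_P: "(cmod (poly P v))\<^sup>2
      = (cmod (lead_coeff P))\<^sup>2 * (\<Prod>i=1..n. (cmod (v - complex_of_real (z i)))\<^sup>2)" for v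
    by (simp add: poly_P norm_mult power_mult_distrib prod_power_distrib flip: prod_norm)
  have "(cmod (1 - complex_of_real w))\<^sup>2 = (1 - w)\<^sup>2" for w
    by (simp add: cmod_power2)
  then have normalization: "(cmod (lead_coeff P))\<^sup>2 * (\<Prod>i=1..n. (1 - z i)\<^sup>2) = 1"
    using cmod_P[of 1] assms(1) by simp
  have "(cmod (poly P u))\<^sup>2 = (cmod (lead_coeff P))\<^sup>2 *
      (\<Prod>i=1..n. (1 - z i)\<^sup>2 * (root_transform (z i) * (1 - Re u) + Re u))"
    unfolding cmod_P using cmod_sub_real_root[OF assms(3)] z_ne_1
    by (intro arg_cong2[where f = "(*)"] prod.cong refl) simp
  then show ?thesis
    using normalization by (simp add: prod.distrib flip: mult.assoc)
qed

theorem theorem1: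
  fixes P :: "complex poly" and n :: nat and z :: "nat \<Rightarrow> real" and \<rho> :: "nat \<Rightarrow> real"
  assumes "n \<ge> 1"
    and "degree P = n"
    and "poly P 1 = 1"
    and "proots P = image_mset (\<lambda>i. complex_of_real (z i)) (mset_set {1..n})"
    and "\<exists>i\<in>{1..n}. z i = -1"
    and "\<rho> = norm_elem_sym n (\<lambda>i. root_transform (z i))"
    and "\<forall>k\<le>n div 2.
           (\<Sum>j=n - 2*k..n. of_nat ((2*k) choose (n - j)) * (-1)^(n - j) * \<rho> j) \<ge> 0"
  shows "\<forall>\<phi>::real. T P \<phi> \<le> 1"
proof
  fix \<phi> :: real
  define a where "a = (\<lambda>i. root_transform (z i))"
  define E where "E m = (\<Sum>j\<le>n. of_nat (m choose (n - j)) * (-1) ^ (n - j) * \<rho> j)" for m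
  define Q where "Q c = (\<Prod>i=1..n. a i * (1 - c) + c)" for c
  define c where "c = cos \<phi>"

  have "T P \<phi> = Q c + Q (- c)"
    using cmod_poly_real_roots_unit_circle[OF assms(3,4)]
    by (simp add: T_def Q_def a_def c_def)
  moreover have "Q c + Q (- c) \<le> Q 1 + Q (- 1)"
  proof -
    have Q_eq: "Q x = (\<Sum>m\<le>n. of_nat (n choose m) * E m * (- x) ^ m)" for x
      unfolding Q_def E_def assms(6) a_def by (rule prod_affine_difference_expansion)
    have Q_sum: "Q x + Q (- x) = (\<Sum>m\<le>n. of_nat (n choose m) * E m * ((- x) ^ m + x ^ m))" for x
      by (simp add: Q_eq distrib_left sum.distrib)
    have "of_nat (n choose m) * E m * ((- c) ^ m + c ^ m)
        \<le> of_nat (n choose m) * E m * ((- 1) ^ m + 1 ^ m)" if "m \<le> n" for m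
    proof (cases "even m")
      case True
      then obtain k where k: "m = 2 * k" by blast
      have "E m = (\<Sum>j=n - 2*k..n. of_nat ((2*k) choose (n - j)) * (-1)^(n - j) * \<rho> j)"
        unfolding E_def k by (rule sum.mono_neutral_right) auto
      then have "0 \<le> E m"
        using assms(7) that k by simp
      moreover have "c ^ m \<le> 1"
        using power_le_one[of "\<bar>c\<bar>" m] True by (simp add: c_def power_even_abs)
      ultimately show ?thesis
        using True by (intro mult_left_mono) auto
    qed simp
    then show ?thesis
      unfolding Q_sum by (intro sum_mono) simp
  qed
  moreover have "Q 1 = 1"
    by (simp add: Q_def)
  moreover have "Q (- 1) = 0"
  proof -
    obtain i where i: "i \<in> {1..n}" "z i = -1"
      using assms(5) by blast
    then have "a i * (1 - (- 1)) + (- 1) = 0"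
      by (simp add: a_def root_transform_def)
    then show ?thesis
      unfolding Q_def using i(1) by (intro prod_zero) blast+
  qed
  ultimately show "T P \<phi> \<le> 1"
    by simp
qed

end
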